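(* Let $A$ be an ordered semiring. Then the set $\mathrm{Idl}(A)$ of all ideals of $A$, ordered by inclusion and equipped with the product of ideals $I\cdot J=\langle\{xy\mid x\in I,\,y\in J\}\rangle$ and the unit $A$, is a (commutative) integral quantale $(\mathrm{Idl}(A),\subseteq,A,\cdot)$.
   Context: Semirings are commutative and unital: $(A,0,+)$ and $(A,1,\cdot)$ are commutative monoids with $x\cdot 0=0$ and $x(y+z)=xy+xz$. An ordered semiring is a tuple $(A,\leq,0,1,+,\cdot)$ where $(A,0,1,+,\cdot)$ is a semiring and $\leq$ is a preorder on $A$ with respect to which $+$ and $\cdot$ are monotone. An ideal of an ordered semiring $A$ is a subset $I\subseteq A$ such that: $x\leq y\in I$ implies $x\in I$; $0\in I$; $x,y\in I$ implies $x+y\in I$; and if $x\in I$ or $y\in I$ then $xy\in I$. For $S\subseteq A$, $\langle S\rangle$ denotes the smallest ideal of $A$ containing $S$. A quantale (always unital and commutative) is a tuple $(Q,\leq,1,\cdot)$ where $(Q,\leq)$ is a complete lattice, $(Q,1,\cdot)$ is a commutative monoid, and $x\cdot\bigvee_\lambda y_\lambda=\bigvee_\lambda x\cdot y_\lambda$ for all families $(y_\lambda)$ in $Q$. It is integral if $1$ is the largest element of $(Q,\leq)$. *)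

theory Defs
  imports "HOL-Algebra.Ring" "HOL-Algebra.Complete_Lattice"
begin

text \<open>The order is only a preorder, so it is passed as a relation next to the ring record rather
  than through \<^locale>\<open>partial_order\<close>. The locale \<^locale>\<open>semiring\<close> does not require
  multiplication to be commutative, hence the additional \<^locale>\<open>comm_monoid\<close>; the case
  \<open>\<zero> = \<one>\<close> is allowed.\<close>

locale osemiring = semiring A + comm_monoid A for A (structure) +
  fixes leq :: "'a \<Rightarrow> 'a \<Rightarrow> bool" (infix \<open>\<preceq>\<close> 50)
  assumes leq_refl: "x \<in> carrier A \<Longrightarrow> x \<preceq> x"
    and leq_trans:
      "\<lbrakk>x \<preceq> y; y \<preceq> z; x \<in> carrier A; y \<in> carrier A; z \<in> carrier A\<rbrakk> \<Longrightarrow> x \<preceq> z"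
    and add_leq_mono:
      "\<lbrakk>x \<preceq> x'; y \<preceq> y'; x \<in> carrier A; x' \<in> carrier A; y \<in> carrier A; y' \<in> carrier A\<rbrakk>
        \<Longrightarrow> x \<oplus> y \<preceq> x' \<oplus> y'"
    and mult_leq_mono:
      "\<lbrakk>x \<preceq> x'; y \<preceq> y'; x \<in> carrier A; x' \<in> carrier A; y \<in> carrier A; y' \<in> carrier A\<rbrakk>
        \<Longrightarrow> x \<otimes> y \<preceq> x' \<otimes> y'"

definition oideal :: "('a, 'm) ring_scheme \<Rightarrow> ('a \<Rightarrow> 'a \<Rightarrow> bool) \<Rightarrow> 'a set \<Rightarrow> bool" where
  "oideal A leq I \<longleftrightarrow>
     I \<subseteq> carrier A \<and>
     (\<forall>x\<in>carrier A. \<forall>y\<in>I. leq x y \<longrightarrow> x \<in> I) \<and>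
     \<zero>\<^bsub>A\<^esub> \<in> I \<and>
     (\<forall>x\<in>I. \<forall>y\<in>I. x \<oplus>\<^bsub>A\<^esub> y \<in> I) \<and>
     (\<forall>x\<in>carrier A. \<forall>y\<in>carrier A. x \<in> I \<or> y \<in> I \<longrightarrow> x \<otimes>\<^bsub>A\<^esub> y \<in> I)"

definition Idl :: "('a, 'm) ring_scheme \<Rightarrow> ('a \<Rightarrow> 'a \<Rightarrow> bool) \<Rightarrow> 'a set set" where
  "Idl A leq = {I. oideal A leq I}"

definition genoideal :: "('a, 'm) ring_scheme \<Rightarrow> ('a \<Rightarrow> 'a \<Rightarrow> bool) \<Rightarrow> 'a set \<Rightarrow> 'a set" where
  "genoideal A leq S = \<Inter>{I \<in> Idl A leq. S \<subseteq> I}"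

lemma (in osemiring) oideal_carrier: "oideal A leq (carrier A)"
  by (auto simp: oideal_def)

text \<open>The intersection is indeed the smallest ideal containing \<open>S\<close>.\<close>

lemma (in osemiring) genoideal_smallest:
  assumes "S \<subseteq> carrier A"
  shows "oideal A leq (genoideal A leq S)"
    and "S \<subseteq> genoideal A leq S"
    and "\<And>I. oideal A leq I \<Longrightarrow> S \<subseteq> I \<Longrightarrow> genoideal A leq S \<subseteq> I"
proof -
  have "genoideal A leq S \<subseteq> carrier A"
    using assms oideal_carrier by (auto simp: genoideal_def Idl_def)
  then show "oideal A leq (genoideal A leq S)"
    unfolding genoideal_def Idl_def oideal_def by blast
qed (auto simp: genoideal_def Idl_def)

definition oideal_mult ::
    "('a, 'm) ring_scheme \<Rightarrow> ('a \<Rightarrow> 'a \<Rightarrow> bool) \<Rightarrow> 'a set \<Rightarrow> 'a set \<Rightarrow> 'a set" where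
  "oideal_mult A leq I J = genoideal A leq {x \<otimes>\<^bsub>A\<^esub> y | x y. x \<in> I \<and> y \<in> J}"

abbreviation order_on_carrier ::
    "('q, 'm) partial_object_scheme \<Rightarrow> ('q \<Rightarrow> 'q \<Rightarrow> bool) \<Rightarrow> 'q gorder" where
  "order_on_carrier Q leq \<equiv> \<lparr>carrier = carrier Q, eq = (=), le = leq\<rparr>"

text \<open>The join of a family depends only on its set of members, so distributivity is stated for
  arbitrary (also empty) subsets of the carrier.\<close>

locale quantale = comm_monoid Q for Q (structure) +
  fixes leq :: "'q \<Rightarrow> 'q \<Rightarrow> bool"
  assumes complete_lattice: "complete_lattice (order_on_carrier Q leq)"
    and mult_Sup_distrib:
      "\<lbrakk>x \<in> carrier Q; Y \<subseteq> carrier Q\<rbrakk> \<Longrightarrow>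
        x \<otimes> \<Squnion>\<^bsub>order_on_carrier Q leq\<^esub> Y
          = \<Squnion>\<^bsub>order_on_carrier Q leq\<^esub> {x \<otimes> y | y. y \<in> Y}"

locale integral_quantale = quantale Q leq for Q (structure) and leq +
  assumes one_greatest: "x \<in> carrier Q \<Longrightarrow> leq x \<one>"

end

(* For an ideal K and any U, the residual {y. xy in K for all x in U} is again an ideal. Hence
   a product of generated ideals is generated by the products of the generators, which makes
   associativity and distributivity over joins statements about products of elements. *)

theory Submission imports Defs begin

context osemiring
begin

section \<open>Generated ideals and residuals\<close>

lemma genoideal_subset_iff:
  assumes "S \<subseteq> carrier A" "oideal A (\<preceq>) K"
  shows "genoideal A (\<preceq>) S \<subseteq> K \<longleftrightarrow> S \<subseteq> K"
  using genoideal_smallest(2,3)[of S] assms by blast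

text \<open>A generated ideal is the intersection of the ideals above its generators, so it depends
  only on which ideals those are. Equalities of generated ideals are reduced to tests against an
  arbitrary ideal \<open>K\<close>.\<close>

lemma genoideal_eqI:
  assumes "S \<subseteq> carrier A" "T \<subseteq> carrier A"
    and "\<And>K. oideal A (\<preceq>) K \<Longrightarrow> S \<subseteq> K \<longleftrightarrow> T \<subseteq> K"
  shows "genoideal A (\<preceq>) S = genoideal A (\<preceq>) T"
  using assms by (auto simp: genoideal_def Idl_def)

lemma genoideal_oideal:
  assumes "oideal A (\<preceq>) I"
  shows "genoideal A (\<preceq>) I = I"
  using assms by (auto simp: genoideal_def Idl_def)

lemma oideal_subset_carrier: "oideal A (\<preceq>) I \<Longrightarrow> I \<subseteq> carrier A"
  by (simp add: oideal_def)

lemma genoideal_subset_carrier: "S \<subseteq> carrier A \<Longrightarrow> genoideal A (\<preceq>) S \<subseteq> carrier A"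
  by (simp add: genoideal_smallest(1) oideal_subset_carrier)

text \<open>Multiplication by a fixed \<open>x\<close> is monotone and additive, sends
  \<open>\<zero>\<close> to \<open>\<zero>\<close>, and can be reassociated past a further factor.
  Each closure property of \<open>K\<close> therefore pulls back along it, for all \<open>x\<close>
  in \<open>U\<close> at once.\<close>

lemma oideal_residual:
  assumes U: "U \<subseteq> carrier A" and K: "oideal A (\<preceq>) K"
  shows "oideal A (\<preceq>) {y \<in> carrier A. \<forall>x\<in>U. x \<otimes> y \<in> K}"
proof -
  note K' = K[unfolded oideal_def]
  have down: "x \<otimes> y \<in> K"
    if "x \<in> U" "y \<in> carrier A" "z \<in> carrier A" "y \<preceq> z" "x \<otimes> z \<in> K" for x y z
    using that U K' mult_leq_mono[of x x y z] leq_refl[of x] by blast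
  have mult: "x \<otimes> (y \<otimes> z) \<in> K"
    if "x \<in> U" "y \<in> carrier A" "z \<in> carrier A" "x \<otimes> y \<in> K" for x y z
  proof -
    have "x \<in> carrier A" using that U by blast
    moreover have "(x \<otimes> y) \<otimes> z \<in> K" using that K' by blast
    ultimately show ?thesis using that by (simp add: m_assoc)
  qed
  have mult': "x \<otimes> (z \<otimes> y) \<in> K"
    if "x \<in> U" "y \<in> carrier A" "z \<in> carrier A" "x \<otimes> y \<in> K" for x y z
    using mult[OF that] that by (simp add: m_comm)
  have "x \<otimes> \<zero> \<in> K" if "x \<in> U" for x
    using that U K' r_null[of x] by auto
  moreover have "x \<otimes> (y \<oplus> z) \<in> K"
    if "x \<in> U" "y \<in> carrier A" "z \<in> carrier A" "x \<otimes> y \<in> K" "x \<otimes> z \<in> K" for x y z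
    using that U K' r_distr[of y z x] by auto
  ultimately show ?thesis
    unfolding oideal_def using down mult mult' by auto
qed

text \<open>Both sides say that a set lies in the residual of \<open>K\<close> by \<open>U\<close>.
  The residual is an ideal, so it contains \<open>T\<close> exactly when it contains the ideal
  generated by \<open>T\<close>.\<close>

lemma mult_genoideal_right_subset_iff:
  assumes "U \<subseteq> carrier A" "T \<subseteq> carrier A" "oideal A (\<preceq>) K"
  shows "(\<forall>x\<in>U. \<forall>y\<in>genoideal A (\<preceq>) T. x \<otimes> y \<in> K) \<longleftrightarrow> (\<forall>x\<in>U. \<forall>y\<in>T. x \<otimes> y \<in> K)"
  using genoideal_subset_iff[OF assms(2) oideal_residual[OF assms(1,3)]]
    genoideal_subset_carrier[OF assms(2)] assms(2)
  by blast

text \<open>Carries the preceding equivalence over from the right factor to the left one.\<close>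

lemma mult_comm_ball_iff:
  assumes "U \<subseteq> carrier A" "V \<subseteq> carrier A"
  shows "(\<forall>x\<in>U. \<forall>y\<in>V. x \<otimes> y \<in> K) \<longleftrightarrow> (\<forall>y\<in>V. \<forall>x\<in>U. y \<otimes> x \<in> K)"
proof -
  have "x \<otimes> y = y \<otimes> x" if "x \<in> U" "y \<in> V" for x y
    using assms that by (intro m_comm) auto
  then show ?thesis by metis
qed

lemma oideal_mult_genoideal:
  assumes S: "S \<subseteq> carrier A" and T: "T \<subseteq> carrier A"
  shows "oideal_mult A (\<preceq>) (genoideal A (\<preceq>) S) (genoideal A (\<preceq>) T)
    = genoideal A (\<preceq>) {x \<otimes> y | x y. x \<in> S \<and> y \<in> T}"
  unfolding oideal_mult_def
proof (rule genoideal_eqI)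
  note gS = genoideal_subset_carrier[OF S] and gT = genoideal_subset_carrier[OF T]
  show "{x \<otimes> y | x y. x \<in> genoideal A (\<preceq>) S \<and> y \<in> genoideal A (\<preceq>) T} \<subseteq> carrier A"
    using gS gT by auto
  show "{x \<otimes> y | x y. x \<in> S \<and> y \<in> T} \<subseteq> carrier A"
    using S T by auto
  fix K assume K: "oideal A (\<preceq>) K"
  \<comment> \<open>One factor is treated at a time: the right one shrinks to \<open>T\<close>
    against the whole ideal generated by \<open>S\<close>; then the factors are swapped, the ideal
    shrinks to \<open>S\<close> against \<open>T\<close>, and they are swapped back.\<close>
  have "(\<forall>x\<in>genoideal A (\<preceq>) S. \<forall>y\<in>genoideal A (\<preceq>) T. x \<otimes> y \<in> K)
      \<longleftrightarrow> (\<forall>x\<in>S. \<forall>y\<in>T. x \<otimes> y \<in> K)"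
    using mult_genoideal_right_subset_iff[OF gS T K] mult_genoideal_right_subset_iff[OF T S K]
      mult_comm_ball_iff[OF gS T, of K] mult_comm_ball_iff[OF S T, of K]
    by blast
  then show "{x \<otimes> y | x y. x \<in> genoideal A (\<preceq>) S \<and> y \<in> genoideal A (\<preceq>) T} \<subseteq> K
      \<longleftrightarrow> {x \<otimes> y | x y. x \<in> S \<and> y \<in> T} \<subseteq> K"
    by blast
qed

section \<open>The commutative monoid of ideals\<close>

lemma oideal_oideal_mult:
  assumes "I \<subseteq> carrier A" "J \<subseteq> carrier A"
  shows "oideal A (\<preceq>) (oideal_mult A (\<preceq>) I J)"
  unfolding oideal_mult_def using assms by (intro genoideal_smallest(1)) auto

lemma oideal_mult_comm:
  assumes "I \<subseteq> carrier A" "J \<subseteq> carrier A"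
  shows "oideal_mult A (\<preceq>) I J = oideal_mult A (\<preceq>) J I"
proof -
  have "{x \<otimes> y | x y. x \<in> I \<and> y \<in> J} = {x \<otimes> y | x y. x \<in> J \<and> y \<in> I}"
  proof -
    have "x \<otimes> y = y \<otimes> x" if "x \<in> I" "y \<in> J" for x y
      using assms that by (intro m_comm) auto
    then show ?thesis by (intro Collect_cong) metis
  qed
  then show ?thesis by (simp add: oideal_mult_def)
qed

text \<open>Either bracketing is generated by the threefold products of elements, so associativity
  in \<open>A\<close> suffices.\<close>

lemma oideal_mult_assoc:
  assumes I: "oideal A (\<preceq>) I" and J: "oideal A (\<preceq>) J" and L: "oideal A (\<preceq>) L"
  shows "oideal_mult A (\<preceq>) (oideal_mult A (\<preceq>) I J) L
    = oideal_mult A (\<preceq>) I (oideal_mult A (\<preceq>) J L)"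
proof -
  note sub = I[THEN oideal_subset_carrier] J[THEN oideal_subset_carrier]
    L[THEN oideal_subset_carrier]
  let ?P = "\<lambda>U V. {x \<otimes> y | x y. x \<in> U \<and> y \<in> V}"
  have P: "?P I J \<subseteq> carrier A" "?P J L \<subseteq> carrier A"
    using sub by auto
  have assoc: "(x \<otimes> y) \<otimes> z = x \<otimes> (y \<otimes> z)" if "x \<in> I" "y \<in> J" "z \<in> L" for x y z
    using that sub by (intro m_assoc) auto
  have "?P (?P I J) L = {(x \<otimes> y) \<otimes> z | x y z. x \<in> I \<and> y \<in> J \<and> z \<in> L}"
    by blast
  also have "\<dots> = {x \<otimes> (y \<otimes> z) | x y z. x \<in> I \<and> y \<in> J \<and> z \<in> L}"
    by (intro Collect_cong ex_cong1) (auto simp: assoc)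
  also have "\<dots> = ?P I (?P J L)"
    by blast
  finally have eq: "?P (?P I J) L = ?P I (?P J L)" .
  \<comment> \<open>The ideal \<open>L\<close> generates itself, so
    \<open>oideal_mult_genoideal\<close> applies with the generators \<open>?P I J\<close> and
    \<open>L\<close>.\<close>
  have "oideal_mult A (\<preceq>) (oideal_mult A (\<preceq>) I J) L = genoideal A (\<preceq>) (?P (?P I J) L)"
    using oideal_mult_genoideal[OF P(1) sub(3)] genoideal_oideal[OF L]
    by (simp add: oideal_mult_def[of _ _ I J])
  moreover have "oideal_mult A (\<preceq>) I (oideal_mult A (\<preceq>) J L) = genoideal A (\<preceq>) (?P I (?P J L))"
    using oideal_mult_genoideal[OF sub(1) P(2)] genoideal_oideal[OF I]
    by (simp add: oideal_mult_def[of _ _ J L])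
  ultimately show ?thesis
    by (simp only: eq)
qed

text \<open>The generating products already form \<open>I\<close>: absorption gives one inclusion,
  multiplication by \<open>\<one>\<close> the other.\<close>

lemma oideal_mult_carrier_left:
  assumes I: "oideal A (\<preceq>) I"
  shows "oideal_mult A (\<preceq>) (carrier A) I = I"
proof -
  note sub = oideal_subset_carrier[OF I]
  have "{x \<otimes> y | x y. x \<in> carrier A \<and> y \<in> I} = I" (is "?P = I")
  proof
    show "?P \<subseteq> I"
      using I unfolding oideal_def by blast
    show "I \<subseteq> ?P"
    proof
      fix y assume "y \<in> I"
      moreover from this have "y = \<one> \<otimes> y" using sub by auto
      ultimately show "y \<in> ?P" by blast
    qed
  qed
  then show ?thesis
    by (simp add: oideal_mult_def genoideal_oideal[OF I])
qed

text \<open>Distributivity over joins: both sides are generated by the products of an element of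
  \<open>I\<close> with an element of a member of \<open>Y\<close>.\<close>

lemma oideal_mult_genoideal_Union:
  assumes I: "oideal A (\<preceq>) I" and Y: "Y \<subseteq> Idl A (\<preceq>)"
  shows "oideal_mult A (\<preceq>) I (genoideal A (\<preceq>) (\<Union>Y))
    = genoideal A (\<preceq>) (\<Union>{oideal_mult A (\<preceq>) I J | J. J \<in> Y})"
proof -
  note sub = oideal_subset_carrier[OF I]
  have subY: "J \<subseteq> carrier A" if "J \<in> Y" for J
    using that Y oideal_subset_carrier by (auto simp: Idl_def)
  have "oideal_mult A (\<preceq>) I (genoideal A (\<preceq>) (\<Union>Y))
      = genoideal A (\<preceq>) {x \<otimes> y | x y. x \<in> I \<and> y \<in> \<Union>Y}"
    using oideal_mult_genoideal[OF sub, of "\<Union>Y"] subY genoideal_oideal[OF I] by auto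
  also have "\<dots> = genoideal A (\<preceq>) (\<Union>{oideal_mult A (\<preceq>) I J | J. J \<in> Y})"
  proof (rule genoideal_eqI)
    show "{x \<otimes> y | x y. x \<in> I \<and> y \<in> \<Union>Y} \<subseteq> carrier A"
      using sub subY by blast
    show "\<Union>{oideal_mult A (\<preceq>) I J | J. J \<in> Y} \<subseteq> carrier A"
      using oideal_subset_carrier[OF oideal_oideal_mult[OF sub subY]] by blast
    fix K assume K: "oideal A (\<preceq>) K"
    \<comment> \<open>Inside the test against \<open>K\<close>, each product ideal may be replaced
      by its generators.\<close>
    have "oideal_mult A (\<preceq>) I J \<subseteq> K \<longleftrightarrow> {x \<otimes> y | x y. x \<in> I \<and> y \<in> J} \<subseteq> K" if "J \<in> Y" for J
      unfolding oideal_mult_def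
      by (rule genoideal_subset_iff[OF _ K]) (use sub subY[OF that] in blast)
    then have "\<Union>{oideal_mult A (\<preceq>) I J | J. J \<in> Y} \<subseteq> K
        \<longleftrightarrow> (\<forall>J\<in>Y. {x \<otimes> y | x y. x \<in> I \<and> y \<in> J} \<subseteq> K)"
      by (simp add: Setcompr_eq_image UN_subset_iff)
    then show "{x \<otimes> y | x y. x \<in> I \<and> y \<in> \<Union>Y} \<subseteq> K
        \<longleftrightarrow> \<Union>{oideal_mult A (\<preceq>) I J | J. J \<in> Y} \<subseteq> K"
      by (simp only:) blast
  qed
  finally show ?thesis .
qed

section \<open>The complete lattice of ideals\<close>

abbreviation Idl_order :: "'a set gorder" where
  "Idl_order \<equiv> \<lparr>carrier = Idl A (\<preceq>), eq = (=), le = (\<subseteq>)\<rparr>"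

lemma partial_order_Idl: "partial_order Idl_order"
  by unfold_locales auto

lemma least_Upper_Idl:
  assumes "Y \<subseteq> Idl A (\<preceq>)"
  shows "least Idl_order (genoideal A (\<preceq>) (\<Union>Y)) (Upper Idl_order Y)"
proof -
  have sub: "\<Union>Y \<subseteq> carrier A"
    using assms oideal_subset_carrier by (auto simp: Idl_def)
  have "Upper Idl_order Y = {I. oideal A (\<preceq>) I \<and> \<Union>Y \<subseteq> I}"
    using assms by (auto simp: Upper_def Idl_def)
  then show ?thesis
    using genoideal_smallest[OF sub] by (auto simp: least_def Idl_def)
qed

lemma Sup_Idl:
  assumes "Y \<subseteq> Idl A (\<preceq>)"
  shows "\<Squnion>\<^bsub>Idl_order\<^esub> Y = genoideal A (\<preceq>) (\<Union>Y)"
proof -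
  \<comment> \<open>The library supremum is a choice among least upper bounds: existence makes the
    choice a least upper bound, and uniqueness then identifies it.\<close>
  have "least Idl_order (\<Squnion>\<^bsub>Idl_order\<^esub> Y) (Upper Idl_order Y)"
    unfolding Lattice.sup_def by (rule someI) (rule least_Upper_Idl[OF assms])
  then show ?thesis
    using partial_order.least_unique[OF partial_order_Idl] least_Upper_Idl[OF assms] by blast
qed

text \<open>The ideal generated by the intersection lies in every member of \<open>Y\<close>, hence
  equals the intersection. Since \<open>\<Inter>{}\<close> is the whole type, which may exceed the
  carrier, \<open>Y\<close> is taken nonempty.\<close>

lemma oideal_Inter:
  assumes "\<And>I. I \<in> Y \<Longrightarrow> oideal A (\<preceq>) I" "Y \<noteq> {}"
  shows "oideal A (\<preceq>) (\<Inter>Y)"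
proof -
  have sub: "\<Inter>Y \<subseteq> carrier A"
    using assms oideal_subset_carrier by blast
  have "genoideal A (\<preceq>) (\<Inter>Y) \<subseteq> I" if "I \<in> Y" for I
    using assms(1) that by (intro genoideal_smallest(3)[OF sub]) auto
  then have "genoideal A (\<preceq>) (\<Inter>Y) = \<Inter>Y"
    using genoideal_smallest(2)[OF sub] by blast
  then show ?thesis
    using genoideal_smallest(1)[OF sub] by simp
qed

lemma complete_lattice_Idl: "complete_lattice Idl_order"
proof (rule partial_order.complete_latticeI[OF partial_order_Idl])
  fix Y assume "Y \<subseteq> carrier Idl_order"
  then have Y: "Y \<subseteq> Idl A (\<preceq>)" by simp
  then show "\<exists>s. least Idl_order s (Upper Idl_order Y)"
    using least_Upper_Idl by blast
  \<comment> \<open>Inserting \<open>carrier A\<close> gives the empty family the meet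
    \<open>carrier A\<close> and leaves the intersection of any other family of ideals
    unchanged.\<close>
  have "oideal A (\<preceq>) J" if "J \<in> insert (carrier A) Y" for J
    using that Y oideal_carrier by (auto simp: Idl_def)
  then have "oideal A (\<preceq>) (\<Inter>(insert (carrier A) Y))"
    by (intro oideal_Inter) auto
  moreover have "Lower Idl_order Y = {I. oideal A (\<preceq>) I \<and> I \<subseteq> \<Inter>(insert (carrier A) Y)}"
    using Y oideal_subset_carrier by (auto simp: Lower_def Idl_def)
  ultimately have "greatest Idl_order (\<Inter>(insert (carrier A) Y)) (Lower Idl_order Y)"
    by (auto simp: greatest_def Idl_def)
  then show "\<exists>i. greatest Idl_order i (Lower Idl_order Y)" by blast
qed

lemma integral_quantale_Idl:
  "integral_quantale
    \<lparr>carrier = Idl A (\<preceq>), mult = oideal_mult A (\<preceq>), one = carrier A\<rparr> (\<subseteq>)"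
  (is "integral_quantale ?Q _")
proof -
  have IdlD: "oideal A (\<preceq>) I" if "I \<in> Idl A (\<preceq>)" for I
    using that by (simp add: Idl_def)
  have closed: "oideal_mult A (\<preceq>) I J \<in> Idl A (\<preceq>)" if "I \<in> Idl A (\<preceq>)" "J \<in> Idl A (\<preceq>)" for I J
    using that oideal_oideal_mult oideal_subset_carrier by (auto simp: Idl_def)
  have carrier_Idl: "carrier A \<in> Idl A (\<preceq>)"
    by (simp add: Idl_def oideal_carrier)
  have "comm_monoid ?Q"
  proof (rule comm_monoidI)
    fix I J assume "I \<in> carrier ?Q" "J \<in> carrier ?Q"
    then show "I \<otimes>\<^bsub>?Q\<^esub> J = J \<otimes>\<^bsub>?Q\<^esub> I"
      using oideal_mult_comm[OF IdlD[THEN oideal_subset_carrier] IdlD[THEN oideal_subset_carrier]]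
      by simp
  qed (simp_all add: closed IdlD oideal_mult_assoc oideal_mult_carrier_left carrier_Idl)
  moreover have "quantale_axioms ?Q (\<subseteq>)"
  proof (rule quantale_axioms.intro)
    show "complete_lattice (order_on_carrier ?Q (\<subseteq>))"
      using complete_lattice_Idl by simp
    fix I Y assume "I \<in> carrier ?Q" "Y \<subseteq> carrier ?Q"
    then have I: "I \<in> Idl A (\<preceq>)" and Y: "Y \<subseteq> Idl A (\<preceq>)" by simp_all
    \<comment> \<open>This lets \<open>Sup_Idl\<close> rewrite the join on the right as well, so
      that both joins become generated ideals.\<close>
    have "{oideal_mult A (\<preceq>) I J | J. J \<in> Y} \<subseteq> Idl A (\<preceq>)"
      using closed I Y by blast
    then show "I \<otimes>\<^bsub>?Q\<^esub> \<Squnion>\<^bsub>order_on_carrier ?Q (\<subseteq>)\<^esub> Y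
        = \<Squnion>\<^bsub>order_on_carrier ?Q (\<subseteq>)\<^esub> {I \<otimes>\<^bsub>?Q\<^esub> y | y. y \<in> Y}"
      using oideal_mult_genoideal_Union[OF IdlD[OF I] Y] by (simp add: Sup_Idl Y)
  qed
  moreover have "integral_quantale_axioms ?Q (\<subseteq>)"
    by unfold_locales (simp add: IdlD oideal_subset_carrier)
  ultimately show ?thesis
    by (simp add: integral_quantale_def quantale_def)
qed

end

theorem mainTheorem3:
  fixes A :: "('a, 'm) ring_scheme" and leq :: "'a \<Rightarrow> 'a \<Rightarrow> bool"
  assumes "osemiring A leq"
  shows "integral_quantale
    \<lparr>carrier = Idl A leq, mult = oideal_mult A leq, one = carrier A\<rparr> (\<subseteq>)"
  by (rule osemiring.integral_quantale_Idl[OF assms])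

end
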